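(* Let $S$ be a nonempty set, let $F$ be $\mathbb{Q}$, $\mathbb{R}$ or $\mathbb{C}$, let $B$ be a Banach space over $F$, let $\rho:S\to S$ be a permutation (bijection) of $S$, and let $p:S\to F\setminus\{0\}$, $q:S\to B$ and $\psi:S\to[0,\infty)$ be functions. Suppose there exists a positive real number $L<1$ such that $$|p(x)|\,\psi(\rho^{-1}(x))\le L\,\psi(x)\quad\text{for all }x\in S.$$ Then for every function $f:S\to B$ satisfying $$\|f(\rho(x))-p(x)f(x)-q(x)\|\le\psi(x)\quad\text{for all }x\in S,$$ there exists a unique function $T:S\to B$ such that $$T(\rho(x))=p(x)T(x)+q(x)\quad\text{and}\quad \|f(x)-T(x)\|\le\frac{1}{1-L}\,\psi(\rho^{-1}(x))$$ for all $x\in S$.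
   Context: A Banach space over $F$ is a complete normed vector space over $F$, with $F$ carrying the usual absolute value. *)

theory Defs
  imports "HOL-Analysis.Analysis"
begin

text \<open>
  The scalar field is a type \<open>'k\<close> together with its absolute value. It is required to be a copy of
  one of the subfields \<open>\<rat>\<close>, \<open>\<real>\<close>, \<open>\<complex>\<close> of the complex numbers, the absolute value
  being the restriction of the complex modulus. The types \<^typ>\<open>rat\<close>, \<^typ>\<open>real\<close> and
  \<^typ>\<open>complex\<close> with their usual absolute values are instances, see below. The absolute value and
  the norm are explicit functions because \<^const>\<open>norm\<close> presupposes real scalars, which
  excludes \<^typ>\<open>rat\<close> and Banach spaces over it.
\<close>

definition rat_real_or_complex :: "('k::field \<Rightarrow> real) \<Rightarrow> bool" where
  "rat_real_or_complex absv \<longleftrightarrow>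
    (\<exists>\<iota> :: 'k \<Rightarrow> complex.
      (\<forall>a b. \<iota> (a + b) = \<iota> a + \<iota> b) \<and> (\<forall>a b. \<iota> (a * b) = \<iota> a * \<iota> b) \<and> \<iota> 1 = 1 \<and> inj \<iota> \<and>
      (range \<iota> = \<rat> \<or> range \<iota> = \<real> \<or> range \<iota> = UNIV) \<and>
      (\<forall>a. absv a = cmod (\<iota> a)))"

lemma rat_real_or_complex_rat: "rat_real_or_complex (\<lambda>a :: rat. \<bar>real_of_rat a\<bar>)"
proof -
  have "cmod (of_rat a) = \<bar>real_of_rat a\<bar>" for a :: rat
    by (cases a) (simp add: of_rat_rat norm_divide)
  then show ?thesis
    unfolding rat_real_or_complex_def
    by (intro exI[of _ of_rat]) (auto simp: of_rat_add of_rat_mult Rats_def inj_on_def)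
qed

lemma rat_real_or_complex_real: "rat_real_or_complex (\<lambda>a :: real. \<bar>a\<bar>)"
  unfolding rat_real_or_complex_def
  by (intro exI[of _ complex_of_real]) (auto simp: Reals_def inj_on_def)

lemma rat_real_or_complex_complex: "rat_real_or_complex cmod"
  unfolding rat_real_or_complex_def by (intro exI[of _ "\<lambda>a. a"]) auto

locale normed_space_over = vector_space scale
  for scale :: "'k::field \<Rightarrow> 'b::ab_group_add \<Rightarrow> 'b" +
  fixes absv :: "'k \<Rightarrow> real"
    and nrm :: "'b \<Rightarrow> real"
  assumes nrm_nonneg: "0 \<le> nrm v"
    and nrm_eq_0_iff: "nrm v = 0 \<longleftrightarrow> v = 0"
    and nrm_triangle: "nrm (v + w) \<le> nrm v + nrm w"
    and nrm_scale: "nrm (scale a v) = absv a * nrm v"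
begin

lemma nrm_minus_commute: "nrm (v - w) = nrm (w - v)"
proof -
  define u where "u = v - w"
  have neg: "nrm (- x) = absv (- 1) * nrm x" for x
    using nrm_scale[of "- 1" x] by simp
  have "nrm (- u) = nrm u"
  proof (cases "u = 0")
    case False
    then have pos: "nrm u > 0"
      using nrm_nonneg[of u] nrm_eq_0_iff[of u] by linarith
    have "nrm u = absv (- 1) * (absv (- 1) * nrm u)"
      using neg[of "- u"] neg[of u] by simp
    then have "(absv (- 1))\<^sup>2 = 1"
      using pos by (simp add: power2_eq_square)
    moreover have "absv (- 1) \<ge> 0"
      using neg[of u] nrm_nonneg[of "- u"] pos by (simp add: zero_le_mult_iff)
    ultimately have "absv (- 1) = 1"
      by (simp add: power2_eq_1_iff)
    then show ?thesis
      using neg[of u] by simp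
  qed simp
  then show ?thesis
    by (simp add: u_def)
qed

sublocale metric: Metric_space UNIV "\<lambda>v w. nrm (v - w)"
proof
  show "nrm (x - z) \<le> nrm (x - y) + nrm (y - z)" for x y z
    using nrm_triangle[of "x - y" "y - z"] by simp
qed (auto simp: nrm_nonneg nrm_eq_0_iff nrm_minus_commute)

end

text \<open>Completeness refers to the metric \<open>nrm (v - w)\<close> of the sublocale above.\<close>

locale banach_space_over = normed_space_over +
  assumes complete: "metric.mcomplete"

lemma banach_space_over_real:
  "banach_space_over (scaleR :: real \<Rightarrow> 'b::banach \<Rightarrow> 'b) (\<lambda>a. \<bar>a\<bar>) norm"
proof -
  interpret normed_space_over "scaleR :: real \<Rightarrow> 'b \<Rightarrow> 'b" "\<lambda>a. \<bar>a\<bar>" norm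
    by unfold_locales (auto simp: scaleR_add_right scaleR_add_left norm_triangle_ineq)
  have "(\<lambda>v w :: 'b. norm (v - w)) = dist"
    by (simp add: dist_norm fun_eq_iff)
  then have "metric.mcomplete"
    using complete_UNIV by (simp add: mcomplete_iff_complete)
  then show ?thesis
    by unfold_locales
qed

end

theory Submission
  imports Defs
begin

text \<open>
  The functional equation says that \<open>T\<close> is a fixed point of the operator
  \<open>A g x = p (\<rho>\<^sup>-\<^sup>1 x) g (\<rho>\<^sup>-\<^sup>1 x) + q (\<rho>\<^sup>-\<^sup>1 x)\<close>. By the hypothesis on \<open>L\<close>, it contracts by the
  factor \<open>L\<close> pointwise distances measured in units of \<open>\<phi> x = \<psi> (\<rho>\<^sup>-\<^sup>1 x)\<close>, and it moves \<open>f\<close> by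
  at most \<open>\<phi>\<close>. So the iterates \<open>A\<^sup>n f\<close> converge pointwise to the fixed point, at a distance
  from \<open>f\<close> bounded by a geometric series.
\<close>

text \<open>The weighted supremum distance between two functions can be infinite, and \<phi> can
  vanish, so no metric on the whole function space is formed. Instead \<open>contr\<close> speaks of
  any finite bound \<open>C\<close> on that distance, and completeness is used separately at each
  point.\<close>

lemma weighted_contraction_fixed_point:
  fixes d :: "'a \<Rightarrow> 'a \<Rightarrow> real" and A :: "('s \<Rightarrow> 'a) \<Rightarrow> 's \<Rightarrow> 'a"
    and \<phi> :: "'s \<Rightarrow> real" and L :: real
  assumes "Metric_space UNIV d" and "Metric_space.mcomplete UNIV d"
    and L: "0 \<le> L" "L < 1"
    and contr: "\<And>g h C. 0 \<le> C \<Longrightarrow> (\<And>x. d (g x) (h x) \<le> C * \<phi> x) \<Longrightarrow>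
      (\<And>x. d (A g x) (A h x) \<le> L * C * \<phi> x)"
    and start: "\<And>x. d (f x) (A f x) \<le> \<phi> x"
  shows "\<exists>!T. A T = T \<and> (\<forall>x. d (f x) (T x) \<le> 1 / (1 - L) * \<phi> x)"
proof -
  interpret Metric_space UNIV d by fact
  have \<phi>: "0 \<le> \<phi> x" for x
    using start[of x] nonneg[of "f x" "A f x"] by linarith
  have Lpow: "(\<lambda>n. L ^ n * c) \<longlonglongrightarrow> 0" for c
    using tendsto_mult_left_zero[OF LIMSEQ_realpow_zero[OF L]] .
  have iter: "d ((A ^^ n) g x) ((A ^^ n) h x) \<le> L ^ n * C * \<phi> x"
    if "0 \<le> C" "\<And>x. d (g x) (h x) \<le> C * \<phi> x" for g h C n x
  proof (induction n arbitrary: x)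
    case (Suc n)
    show ?case
      using contr[of "L ^ n * C", OF _ Suc] that(1) L(1) by (simp add: mult.assoc)
  qed (use that in simp)
  define g where "g n = (A ^^ n) f" for n
  have Ag: "A (g n) = g (Suc n)" for n
    by (simp add: g_def)
  have step: "d (g n x) (g (Suc n) x) \<le> L ^ n * \<phi> x" for n x
    using iter[of 1 f "A f" n x] start by (simp add: g_def funpow_swap1)
  \<comment> \<open>The factor is the closed form of the partial geometric sum of
    \<open>L ^ i\<close> over i < k, obtained by adding up \<open>step\<close>.\<close>
  have dist: "d (g n x) (g (n + k) x) \<le> L ^ n * ((1 - L ^ k) / (1 - L) * \<phi> x)" for n k x
  proof (induction k)
    case (Suc k)
    have "d (g n x) (g (n + Suc k) x) \<le> d (g n x) (g (n + k) x) + d (g (n + k) x) (g (Suc (n + k)) x)"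
      by (simp add: triangle)
    also have "\<dots> \<le> L ^ n * ((1 - L ^ k) / (1 - L) * \<phi> x) + L ^ (n + k) * \<phi> x"
      using Suc step[of "n + k" x] by linarith
    also have "\<dots> = L ^ n * ((1 - L ^ Suc k) / (1 - L) * \<phi> x)"
      using L by (simp add: field_simps power_add)
    finally show ?case .
  qed simp
  have bound: "d (g n x) (g m x) \<le> L ^ n * (1 / (1 - L) * \<phi> x)" if "n \<le> m" for n m x
  proof -
    have "(1 - L ^ (m - n)) / (1 - L) * \<phi> x \<le> 1 / (1 - L) * \<phi> x"
      using L \<phi>[of x] by (intro mult_right_mono divide_right_mono) auto
    then have "L ^ n * ((1 - L ^ (m - n)) / (1 - L) * \<phi> x) \<le> L ^ n * (1 / (1 - L) * \<phi> x)"
      using L by (intro mult_left_mono) auto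
    with dist[of n x "m - n"] that show ?thesis by simp
  qed
  have "MCauchy (\<lambda>n. g n x)" for x
    unfolding MCauchy_def
  proof (intro conjI allI impI)
    fix e :: real assume "e > 0"
    then obtain N where "L ^ N * (1 / (1 - L) * \<phi> x) < e / 2"
      using order_tendstoD(2)[OF Lpow, of "e / 2"] unfolding eventually_sequentially
      by (metis half_gt_zero order_refl)
    then have N: "d (g N x) (g n x) < e / 2" if "N \<le> n" for n
      using bound[OF that, of x] by linarith
    have "d (g n x) (g m x) < e" if "N \<le> n" "N \<le> m" for n m
      using N[OF that(1)] N[OF that(2)] triangle[of "g n x" "g N x" "g m x"]
        commute[of "g n x" "g N x"] by simp
    then show "\<exists>N. \<forall>n m. N \<le> n \<longrightarrow> N \<le> m \<longrightarrow> d (g n x) (g m x) < e"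
      by blast
  qed simp
  then have "\<exists>l. limitin mtopology (\<lambda>n. g n x) l sequentially" for x
    using \<open>mcomplete\<close> unfolding mcomplete_def by blast
  then obtain T where T: "(\<lambda>n. d (g n x) (T x)) \<longlonglongrightarrow> 0" for x
    unfolding limitin_metric_dist_null by metis
  \<comment> \<open>Let m tend to infinity in \<open>bound\<close>. The case n = 0 is the required
    estimate for \<open>f\<close>; general n serves to show that \<open>T\<close> is fixed.\<close>
  have gT: "d (g n x) (T x) \<le> (L ^ n * (1 / (1 - L))) * \<phi> x" for n x
  proof (rule LIMSEQ_le_const)
    show "(\<lambda>m. L ^ n * (1 / (1 - L)) * \<phi> x + d (g m x) (T x)) \<longlonglongrightarrow> L ^ n * (1 / (1 - L)) * \<phi> x"
      using tendsto_add[OF tendsto_const T] by simp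
    have "d (g n x) (T x) \<le> L ^ n * (1 / (1 - L)) * \<phi> x + d (g m x) (T x)" if "n \<le> m" for m
      using bound[OF that, of x] triangle[of "g n x" "g m x" "T x"] by (simp add: mult.assoc)
    then show "\<exists>N. \<forall>m\<ge>N. d (g n x) (T x) \<le> L ^ n * (1 / (1 - L)) * \<phi> x + d (g m x) (T x)"
      by blast
  qed
  \<comment> \<open>Pointwise convergence alone would not pass through \<open>A\<close>. But
    \<open>gT\<close> holds at all points with one constant, so \<open>contr\<close> shows that
    \<open>A (g n) = g (Suc n)\<close> converges to \<open>A T\<close> as well as to
    \<open>T\<close>.\<close>
  have "A T x = T x" for x
  proof -
    have "d (g (Suc n) x) (A T x) \<le> L ^ n * (L * (1 / (1 - L)) * \<phi> x)" for n
      using contr[of "L ^ n * (1 / (1 - L))" "g n" T, OF _ gT] L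
      by (simp add: Ag mult_ac)
    then have "d (T x) (A T x) \<le> d (g (Suc n) x) (T x) + L ^ n * (L * (1 / (1 - L)) * \<phi> x)" for n
      using triangle[of "T x" "g (Suc n) x" "A T x"] commute[of "T x"]
      by (smt (verit) UNIV_I)
    moreover have "(\<lambda>n. d (g (Suc n) x) (T x) + L ^ n * (L * (1 / (1 - L)) * \<phi> x)) \<longlonglongrightarrow> 0"
      using tendsto_add[OF LIMSEQ_Suc[OF T] Lpow] by (simp only: add_0_left)
    ultimately have "d (T x) (A T x) \<le> 0"
      by (intro LIMSEQ_le_const) auto
    then show ?thesis
      using nonneg[of "T x" "A T x"] zero[of "T x" "A T x"] by simp
  qed
  then have "A T = T \<and> (\<forall>x. d (f x) (T x) \<le> 1 / (1 - L) * \<phi> x)"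
    using gT[of 0] by (auto simp: g_def)
  \<comment> \<open>Both fixed points are close to \<open>f\<close>, hence at finite weighted
    distance from each other; iterating \<open>A\<close> fixes both and shrinks that distance by
    \<open>L ^ n\<close>.\<close>
  moreover have "U = V"
    if U: "A U = U" "\<forall>x. d (f x) (U x) \<le> 1 / (1 - L) * \<phi> x"
      and V: "A V = V" "\<forall>x. d (f x) (V x) \<le> 1 / (1 - L) * \<phi> x" for U V
  proof
    fix x
    have iter_fixed: "(A ^^ n) U = U" "(A ^^ n) V = V" for n
      by (induction n) (simp_all add: U V)
    have "d (U x) (V x) \<le> 2 / (1 - L) * \<phi> x" for x
      using U(2)[rule_format, of x] V(2)[rule_format, of x] triangle[of "U x" "f x" "V x"]
        commute[of "f x" "U x"] by simp
    then have "d (U x) (V x) \<le> L ^ n * (2 / (1 - L) * \<phi> x)" for n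
      using iter[of "2 / (1 - L)" U V n x] L iter_fixed by (simp add: mult.assoc)
    then have "d (U x) (V x) \<le> 0"
      using LIMSEQ_le_const[OF Lpow] by blast
    then show "U x = V x"
      using nonneg[of "U x" "V x"] zero[of "U x" "V x"] by simp
  qed
  ultimately show ?thesis
    by (intro ex1I[of _ T]) blast+
qed

theorem theorem5p4:
  fixes absv :: "'k::field \<Rightarrow> real"
    and scale :: "'k \<Rightarrow> 'b::ab_group_add \<Rightarrow> 'b"
    and nrm :: "'b \<Rightarrow> real"
    and \<rho> :: "'s \<Rightarrow> 's"
    and p :: "'s \<Rightarrow> 'k"
    and q :: "'s \<Rightarrow> 'b"
    and \<psi> :: "'s \<Rightarrow> real"
    and L :: real
    and f :: "'s \<Rightarrow> 'b"
  assumes "rat_real_or_complex absv"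
    and "banach_space_over scale absv nrm"
    and "bij \<rho>"
    and "\<forall>x. p x \<noteq> 0"
    and "\<forall>x. \<psi> x \<ge> 0"
    and "0 < L" and "L < 1"
    and "\<forall>x. absv (p x) * \<psi> (inv \<rho> x) \<le> L * \<psi> x"
    and "\<forall>x. nrm (f (\<rho> x) - scale (p x) (f x) - q x) \<le> \<psi> x"
  shows "\<exists>!T :: 's \<Rightarrow> 'b.
    (\<forall>x. T (\<rho> x) = scale (p x) (T x) + q x \<and>
         nrm (f x - T x) \<le> 1 / (1 - L) * \<psi> (inv \<rho> x))"
proof -
  interpret banach_space_over scale absv nrm by fact
  let ?\<sigma> = "inv \<rho>"
  define A where "A g x = scale (p (?\<sigma> x)) (g (?\<sigma> x)) + q (?\<sigma> x)" for g x
  have \<rho>\<sigma>: "\<rho> (?\<sigma> x) = x" and \<sigma>\<rho>: "?\<sigma> (\<rho> x) = x" for x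
    using \<open>bij \<rho>\<close> by (simp_all add: bij_is_surj surj_f_inv_f bij_is_inj)
  \<comment> \<open>This comes from the complex modulus: over the zero space the norm axioms say
    nothing about \<open>absv\<close>.\<close>
  have absv: "0 \<le> absv a" for a
    using \<open>rat_real_or_complex absv\<close> by (auto simp: rat_real_or_complex_def)
  have "\<exists>!T. A T = T \<and> (\<forall>x. nrm (f x - T x) \<le> 1 / (1 - L) * \<psi> (?\<sigma> x))"
  proof (rule weighted_contraction_fixed_point)
    fix g h :: "'s \<Rightarrow> 'b" and C x
    assume C: "0 \<le> C" and gh: "\<And>x. nrm (g x - h x) \<le> C * \<psi> (?\<sigma> x)"
    let ?y = "?\<sigma> x"
    have "nrm (A g x - A h x) = absv (p ?y) * nrm (g ?y - h ?y)"
      by (simp add: A_def nrm_scale flip: scale_right_diff_distrib)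
    also have "\<dots> \<le> absv (p ?y) * (C * \<psi> (?\<sigma> ?y))"
      by (intro mult_left_mono gh absv)
    also have "\<dots> = C * (absv (p ?y) * \<psi> (?\<sigma> ?y))"
      by simp
    \<comment> \<open>The hypothesis on \<open>L\<close> is taken at \<open>?y\<close>, because the
      weight at \<open>x\<close> is \<open>\<psi> ?y\<close>.\<close>
    also have "\<dots> \<le> C * (L * \<psi> ?y)"
      using assms(8) C by (intro mult_left_mono) auto
    finally show "nrm (A g x - A h x) \<le> L * C * \<psi> ?y"
      by (simp add: mult_ac)
  next
    show "nrm (f x - A f x) \<le> \<psi> (?\<sigma> x)" for x
      using assms(9)[rule_format, of "?\<sigma> x"] by (simp add: A_def \<rho>\<sigma> diff_diff_eq)
  qed (use assms complete metric.Metric_space_axioms in auto)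
  \<comment> \<open>Substituting \<rho> x for x turns the fixed-point equation into the functional
    equation, and surjectivity of \<rho> gives the converse.\<close>
  moreover have "A T = T \<longleftrightarrow> (\<forall>x. T (\<rho> x) = scale (p x) (T x) + q x)" for T
    unfolding fun_eq_iff A_def by (metis \<rho>\<sigma> \<sigma>\<rho>)
  ultimately show ?thesis
    by (simp add: all_conj_distrib)
qed

end
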